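(* Let $G=\mathrm{SL}(2,\mathbf Z)$ and let $V$ be the standard $2$-dimensional $\mathbf CG$-module. There exists a $T$-indecomposable $\mathbf CG$-module $M$ having an ascending filtration $0=M_0\subseteq M_1\subseteq M_2\subseteq\cdots$ by $\mathbf CG$-submodules with $M=\bigcup_n M_n$ and $M_n/M_{n-1}\cong V$ for all $n\in\mathbf N$; and any two $T$-indecomposable $\mathbf CG$-modules having such a filtration are isomorphic.
   Context: $T=\begin{pmatrix}1&1\\0&1\end{pmatrix}$. A $\mathbf CG$-module is called $T$-indecomposable if $T$ acts indecomposably and unipotently on every $T$-invariant subspace. (The paper identifies the module in question as $M_\infty$, the space $E$ with basis $e_1,e_2,\dots$ on which $G$ acts by a representation $\tau$ with $\tau(T)$ the infinite Jordan block and filtration $E_i=\mathrm{span}(e_1,\dots,e_{2i})$.) *)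

theory Defs
  imports "HOL-Analysis.Analysis" "HOL-Computational_Algebra.Polynomial"
begin

definition SL2Z :: "(int ^ 2 ^ 2) set" where
  "SL2Z = {A. det A = 1}"

definition Tmat :: "int ^ 2 ^ 2" where
  "Tmat = (\<chi> i j. if i = 2 \<and> j = 1 then 0 else 1)"

definition CG_module :: "(complex \<Rightarrow> 'v::ab_group_add \<Rightarrow> 'v) \<Rightarrow> (int ^ 2 ^ 2 \<Rightarrow> 'v \<Rightarrow> 'v) \<Rightarrow> bool" where
  "CG_module smul rho \<longleftrightarrow>
     vector_space smul \<and>
     (\<forall>g\<in>SL2Z. Vector_Spaces.linear smul smul (rho g)) \<and>
     rho (mat 1) = id \<and>
     (\<forall>g\<in>SL2Z. \<forall>h\<in>SL2Z. rho (g ** h) = rho g \<circ> rho h)"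

definition CG_submodule :: "(complex \<Rightarrow> 'v::ab_group_add \<Rightarrow> 'v) \<Rightarrow> (int ^ 2 ^ 2 \<Rightarrow> 'v \<Rightarrow> 'v) \<Rightarrow> 'v set \<Rightarrow> bool" where
  "CG_submodule smul rho W \<longleftrightarrow> module.subspace smul W \<and> (\<forall>g\<in>SL2Z. rho g ` W \<subseteq> W)"

definition T_invariant :: "(complex \<Rightarrow> 'v::ab_group_add \<Rightarrow> 'v) \<Rightarrow> (int ^ 2 ^ 2 \<Rightarrow> 'v \<Rightarrow> 'v) \<Rightarrow> 'v set \<Rightarrow> bool" where
  "T_invariant smul rho W \<longleftrightarrow> module.subspace smul W \<and> rho Tmat ` W \<subseteq> W"

definition T_acts_indecomposably :: "(complex \<Rightarrow> 'v::ab_group_add \<Rightarrow> 'v) \<Rightarrow> (int ^ 2 ^ 2 \<Rightarrow> 'v \<Rightarrow> 'v) \<Rightarrow> 'v set \<Rightarrow> bool" where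
  "T_acts_indecomposably smul rho W \<longleftrightarrow>
     \<not> (\<exists>A B. T_invariant smul rho A \<and> T_invariant smul rho B \<and> A \<noteq> {0} \<and> B \<noteq> {0} \<and>
             A \<inter> B = {0} \<and> {a + b | a b. a \<in> A \<and> b \<in> B} = W)"

definition T_acts_unipotently :: "(int ^ 2 ^ 2 \<Rightarrow> 'v::ab_group_add \<Rightarrow> 'v) \<Rightarrow> 'v set \<Rightarrow> bool" where
  "T_acts_unipotently rho W \<longleftrightarrow> (\<forall>w\<in>W. \<exists>n. ((\<lambda>x. rho Tmat x - x) ^^ n) w = 0)"

definition T_indecomposable :: "(complex \<Rightarrow> 'v::ab_group_add \<Rightarrow> 'v) \<Rightarrow> (int ^ 2 ^ 2 \<Rightarrow> 'v \<Rightarrow> 'v) \<Rightarrow> bool" where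
  "T_indecomposable smul rho \<longleftrightarrow>
     (\<forall>W. T_invariant smul rho W \<longrightarrow> T_acts_indecomposably smul rho W \<and> T_acts_unipotently rho W)"

definition std_action :: "int ^ 2 ^ 2 \<Rightarrow> complex ^ 2 \<Rightarrow> complex ^ 2" where
  "std_action g v = (\<chi> i j. of_int (g $ i $ j)) *v v"

text \<open>The quotient F'/F is isomorphic to V as CG-module (F \<subseteq> F' submodules):
  there is a surjective CG-linear map F' \<rightarrow> V with kernel exactly F.\<close>
definition quotient_iso_std :: "(complex \<Rightarrow> 'v::ab_group_add \<Rightarrow> 'v) \<Rightarrow> (int ^ 2 ^ 2 \<Rightarrow> 'v \<Rightarrow> 'v) \<Rightarrow> 'v set \<Rightarrow> 'v set \<Rightarrow> bool" where
  "quotient_iso_std smul rho F' F \<longleftrightarrow>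
     (\<exists>\<phi> :: 'v \<Rightarrow> complex ^ 2.
        (\<forall>x\<in>F'. \<forall>y\<in>F'. \<phi> (x + y) = \<phi> x + \<phi> y) \<and>
        (\<forall>c. \<forall>x\<in>F'. \<phi> (smul c x) = c *s \<phi> x) \<and>
        \<phi> ` F' = UNIV \<and>
        {x\<in>F'. \<phi> x = 0} = F \<and>
        (\<forall>g\<in>SL2Z. \<forall>x\<in>F'. \<phi> (rho g x) = std_action g (\<phi> x)))"

definition good_filtration :: "(complex \<Rightarrow> 'v::ab_group_add \<Rightarrow> 'v) \<Rightarrow> (int ^ 2 ^ 2 \<Rightarrow> 'v \<Rightarrow> 'v) \<Rightarrow> (nat \<Rightarrow> 'v set) \<Rightarrow> bool" where
  "good_filtration smul rho F \<longleftrightarrow>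
     F 0 = {0} \<and>
     (\<forall>n. CG_submodule smul rho (F n)) \<and>
     (\<forall>n. F n \<subseteq> F (Suc n)) \<and>
     (\<Union>n. F n) = UNIV \<and>
     (\<forall>n. quotient_iso_std smul rho (F (Suc n)) (F n))"

definition CG_isomorphic :: "(complex \<Rightarrow> 'a::ab_group_add \<Rightarrow> 'a) \<Rightarrow> (int ^ 2 ^ 2 \<Rightarrow> 'a \<Rightarrow> 'a) \<Rightarrow>
    (complex \<Rightarrow> 'b::ab_group_add \<Rightarrow> 'b) \<Rightarrow> (int ^ 2 ^ 2 \<Rightarrow> 'b \<Rightarrow> 'b) \<Rightarrow> bool" where
  "CG_isomorphic sa ra sb rb \<longleftrightarrow>
     (\<exists>f. bij f \<and> Vector_Spaces.linear sa sb f \<and> (\<forall>g\<in>SL2Z. f \<circ> ra g = rb g \<circ> f))"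

end

theory Submission
  imports Defs
begin

text \<open>
  The group is generated by \<open>S\<close> and \<open>R = S\<^sup>-\<^sup>1 T\<close> with defining relations
  \<open>S\<^sup>2 = R\<^sup>3 = -1\<close> and \<open>-1\<close> an involution: a word that equals the identity reduces to a product
  of \<open>T = S R\<close> and \<open>U = S R\<^sup>2\<close>, which has nonnegative entries, times a few torsion elements.

  On a module filtered by copies of \<open>V\<close> one has \<open>S\<^sup>2 = -1\<close> and \<open>R\<^sup>2 = R - 1\<close>, hence
  \<open>Z = T + T\<^sup>-\<^sup>1 - 2 = T\<^sup>-\<^sup>1 (T - 1)\<^sup>2\<close> is central and maps \<open>M\<^sub>n\<^sub>+\<^sub>1\<close> into \<open>M\<^sub>n\<close>.
  Indecomposability makes the kernel of \<open>T - 1\<close> a line, so the kernel of \<open>Z\<close> is \<open>M\<^sub>1\<close>, and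
  irreducibility of \<open>V\<close> then makes \<open>Z\<close> surjective. Let \<open>\<omega>\<close> be a primitive sixth root of unity. In the
  \<open>\<omega>\<close>-eigenspace of \<open>R\<close> choose \<open>w\<^sub>0 \<in> M\<^sub>1\<close> and \<open>w\<^sub>k\<^sub>+\<^sub>1\<close> with \<open>Z w\<^sub>k\<^sub>+\<^sub>1 = w\<^sub>k\<close>; in the basis
  \<open>w\<^sub>k, S w\<^sub>k\<close> the action of \<open>S\<close> and \<open>R\<close> is forced. These forced formulas also define the module.
\<close>

section \<open>Generators and relations of \<open>SL(2,\<int>)\<close>\<close>

definition mat22 :: "'a \<Rightarrow> 'a \<Rightarrow> 'a \<Rightarrow> 'a \<Rightarrow> 'a ^ 2 ^ 2" where
  "mat22 a b c d = (\<chi> i j. if i = 1 then (if j = 1 then a else b) else (if j = 1 then c else d))"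

lemma mat22_nth [simp]:
  "mat22 a b c d $ 1 $ 1 = a" "mat22 a b c d $ 1 $ 2 = b"
  "mat22 a b c d $ 2 $ 1 = c" "mat22 a b c d $ 2 $ 2 = d"
  by (simp_all add: mat22_def)

lemma mat22_eta: "g = mat22 (g $ 1 $ 1) (g $ 1 $ 2) (g $ 2 $ 1) (g $ 2 $ 2)"
  by (simp add: vec_eq_iff forall_2)

lemma mat22_eq_iff [simp]:
  "mat22 a b c d = mat22 a' b' c' d' \<longleftrightarrow> a = a' \<and> b = b' \<and> c = c' \<and> d = d'"
  by (auto simp: vec_eq_iff forall_2)

lemma mat22_mult [simp]:
  fixes a :: "'a::semiring_1"
  shows "mat22 a b c d ** mat22 a' b' c' d' =
    mat22 (a * a' + b * c') (a * b' + b * d') (c * a' + d * c') (c * b' + d * d')"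
  by (simp add: vec_eq_iff forall_2 matrix_matrix_mult_def sum_2)

lemma mat22_uminus [simp]:
  fixes a :: "'a::group_add"
  shows "- mat22 a b c d = mat22 (- a) (- b) (- c) (- d)"
  by (simp add: vec_eq_iff forall_2)

lemma mat_1_eq_mat22: "mat 1 = mat22 1 0 0 (1::'a::semiring_1)"
  by (simp add: vec_eq_iff forall_2 mat_def)

lemma Tmat_eq_mat22: "Tmat = mat22 1 1 0 1"
  by (simp add: vec_eq_iff forall_2 Tmat_def)

definition Smat :: "int ^ 2 ^ 2" where "Smat = mat22 0 1 (- 1) 0"
definition Rmat :: "int ^ 2 ^ 2" where "Rmat = mat22 0 (- 1) 1 1"
definition Umat :: "int ^ 2 ^ 2" where "Umat = mat22 1 0 1 1"

lemmas mat22_defs = mat_1_eq_mat22 Tmat_eq_mat22 Smat_def Rmat_def Umat_def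

lemma mat22_in_SL2Z: "mat22 a b c d \<in> SL2Z \<longleftrightarrow> a * d - b * c = 1"
  by (simp add: SL2Z_def det_2)

lemma SL2Z_cases:
  assumes "g \<in> SL2Z"
  obtains a b c d where "g = mat22 a b c d" "a * d - b * c = 1"
  using assms mat22_eta[of g] mat22_in_SL2Z by metis

lemma SL2Z_mult [intro]: "g \<in> SL2Z \<Longrightarrow> h \<in> SL2Z \<Longrightarrow> g ** h \<in> SL2Z"
  by (simp add: SL2Z_def det_mul)

lemma SL2Z_gens [simp, intro]:
  "mat 1 \<in> SL2Z" "- mat 1 \<in> SL2Z" "Smat \<in> SL2Z" "Rmat \<in> SL2Z" "Tmat \<in> SL2Z" "Umat \<in> SL2Z"
  by (simp_all add: mat22_defs mat22_in_SL2Z)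

lemma gens_rels:
  "Smat ** Smat = - mat 1" "Rmat ** (Rmat ** Rmat) = - mat 1"
  "Smat ** Rmat = Tmat" "Smat ** (Rmat ** Rmat) = Umat"
  by (simp_all add: mat22_defs)

text \<open>The Euclidean algorithm on the first column reduces a matrix to upper triangular form.
  No inverses of the generators appear, because both have finite order.\<close>

lemma SL2Z_induct [consumes 1, case_names one S R]:
  assumes "g \<in> SL2Z" and one: "P (mat 1)"
    and S: "\<And>g. g \<in> SL2Z \<Longrightarrow> P g \<Longrightarrow> P (Smat ** g)"
    and R: "\<And>g. g \<in> SL2Z \<Longrightarrow> P g \<Longrightarrow> P (Rmat ** g)"
  shows "P g"
proof -
  let ?Q = "\<lambda>a b c d. P (mat22 a b c d)"
  \<comment> \<open>\<open>Smat\<close> has order 4, so the backward direction is three further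
    applications of the forward one. For \<open>Rmat\<close> below, of order 6, it is five.\<close>
  have Siff: "?Q c d (- a) (- b) \<longleftrightarrow> ?Q a b c d" if "a * d - b * c = 1" for a b c d
  proof -
    have *: "?Q c d (- a) (- b)" if "a * d - b * c = 1" "?Q a b c d" for a b c d
      using S[OF _ that(2)] that(1) by (simp add: Smat_def mat22_in_SL2Z)
    show ?thesis
      using *[of a d b c] *[of c "- b" d "- a"] *[of "- a" "- d" "- b" "- c"]
        *[of "- c" b "- d" a] that by (auto simp: algebra_simps)
  qed
  have Riff: "?Q (- c) (- d) (a + c) (b + d) \<longleftrightarrow> ?Q a b c d" if "a * d - b * c = 1" for a b c d
  proof -
    have *: "?Q (- c) (- d) (a + c) (b + d)" if "a * d - b * c = 1" "?Q a b c d" for a b c d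
      using R[OF _ that(2)] that(1) by (simp add: Rmat_def mat22_in_SL2Z)
    show ?thesis
      using *[of a d b c] *[of "- c" "b + d" "- d" "a + c"] *[of "- a - c" b "- b - d" "a"]
        *[of "- a" "- d" "- b" "- c"] *[of c "- b - d" d "- a - c"] *[of "a + c" "- b" "b + d" "- a"]
        that by (auto simp: algebra_simps)
  qed
  have Tiff: "?Q (a + c) (b + d) c d \<longleftrightarrow> ?Q a b c d" if "a * d - b * c = 1" for a b c d
    using Riff[OF that] Siff[of "- c" "b + d" "- d" "a + c"] that by (simp add: algebra_simps)
  have Uiff: "?Q a b (a + c) (b + d) \<longleftrightarrow> ?Q a b c d" if "a * d - b * c = 1" for a b c d
    using Riff[OF that] Riff[of "- c" "b + d" "- d" "a + c"]
      Siff[of "- a - c" b "- b - d" a] that by (simp add: algebra_simps)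
  have upper: "?Q 1 b 0 1" for b
  proof (induction b rule: int_induct[where k = 0])
    case base
    show ?case using one by (simp add: mat_1_eq_mat22)
  next
    case (step1 i)
    then show ?case using Tiff[of 1 1 i 0] by (simp add: add.commute)
  next
    case (step2 i)
    then show ?case using Tiff[of 1 1 "i - 1" 0] by simp
  qed
  have c0: "?Q a b 0 d" if "a * d = 1" for a b d
  proof -
    have "a = 1 \<and> d = 1 \<or> a = -1 \<and> d = -1"
      using that by (simp add: zmult_eq_1_iff)
    moreover have "?Q (- 1) b 0 (- 1)"
      using Siff[of 1 1 "- b" 0] Siff[of 0 b 1 "- 1"] upper[of "- b"] by simp
    ultimately show ?thesis using upper by auto
  qed
  have main: "?Q a b c d" if "a * d - b * c = 1" for a b c d
    using that
  proof (induction "nat \<bar>a\<bar> + nat \<bar>c\<bar>" arbitrary: a b c d rule: less_induct)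
    case less
    \<comment> \<open>If both entries of the first column are nonzero, adding or subtracting the one
      of smaller absolute value shrinks the other; these row operations are powers of
      \<open>Tmat\<close> and \<open>Umat\<close>.\<close>
    consider "c = 0" | "a = 0" | "a \<noteq> 0" "c \<noteq> 0" "\<bar>a - c\<bar> < \<bar>a\<bar>" | "a \<noteq> 0" "c \<noteq> 0" "\<bar>a + c\<bar> < \<bar>a\<bar>"
      | "a \<noteq> 0" "c \<noteq> 0" "\<bar>c - a\<bar> < \<bar>c\<bar>" | "a \<noteq> 0" "c \<noteq> 0" "\<bar>a + c\<bar> < \<bar>c\<bar>"
      by linarith
    then show ?case
    proof cases
      case 1
      then show ?thesis using c0 less.prems by simp
    next
      case 2
      then show ?thesis using Siff[OF less.prems] c0[of c "- b" d] less.prems by (simp add: algebra_simps)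
    next
      case 3
      then have "?Q (a - c) (b - d) c d"
        using less.prems by (intro less.hyps) (simp_all add: algebra_simps)
      then show ?thesis using Tiff[of "a - c" d "b - d" c] less.prems by (simp add: algebra_simps)
    next
      case 4
      then have "?Q (a + c) (b + d) c d"
        using less.prems by (intro less.hyps) (simp_all add: algebra_simps)
      then show ?thesis using Tiff[OF less.prems] by simp
    next
      case 5
      then have "?Q a b (c - a) (d - b)"
        using less.prems by (intro less.hyps) (simp_all add: algebra_simps)
      then show ?thesis using Uiff[of a "d - b" b "c - a"] less.prems by (simp add: algebra_simps)
    next
      case 6
      then have "?Q a b (a + c) (b + d)"
        using less.prems by (intro less.hyps) (simp_all add: algebra_simps)
      then show ?thesis using Uiff[OF less.prems] by simp
    qed
  qed
  show ?thesis using SL2Z_cases[OF assms(1)] main by metis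
qed

lemma SL2Z_inverse:
  assumes "g \<in> SL2Z"
  obtains h where "h \<in> SL2Z" "g ** h = mat 1" "h ** g = mat 1"
proof -
  obtain a b c d where "g = mat22 a b c d" "a * d - b * c = 1"
    using SL2Z_cases[OF assms] .
  then show thesis
    using that[of "mat22 d (- b) (- c) a"] by (simp add: mat22_in_SL2Z mat_1_eq_mat22 algebra_simps)
qed

section \<open>The relations suffice to define an action: a solution of the word problem\<close>

locale SL2Z_relations =
  fixes s r :: "'v::ab_group_add \<Rightarrow> 'v"
  assumes s_s: "s (s x) = - x" and r_r_r: "r (r (r x)) = - x"
    and s_minus: "s (- x) = - s x" and r_minus: "r (- x) = - r x"
begin

text \<open>Pairs a matrix with the operator obtained by evaluating the same word in
  \<open>s\<close> and \<open>r\<close>. That this relation is a function is exactly the claim that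
  the relations present the group.\<close>

inductive graph :: "int ^ 2 ^ 2 \<Rightarrow> ('v \<Rightarrow> 'v) \<Rightarrow> bool" where
  one: "graph (mat 1) id"
| S: "graph g f \<Longrightarrow> graph (Smat ** g) (s \<circ> f)"
| R: "graph g f \<Longrightarrow> graph (Rmat ** g) (r \<circ> f)"

lemma graph_total: "g \<in> SL2Z \<Longrightarrow> \<exists>f. graph g f"
  by (induction rule: SL2Z_induct) (auto intro: graph.intros)

lemma graph_mult: "graph g f \<Longrightarrow> graph h k \<Longrightarrow> graph (g ** h) (f \<circ> k)"
  by (induction rule: graph.induct)
    (auto simp: comp_assoc simp flip: matrix_mul_assoc intro: graph.intros)

text \<open>Normal forms: every word in \<open>S\<close>, \<open>R\<close> is a power of \<open>R\<close> times one of these.\<close>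
inductive pos :: "int ^ 2 ^ 2 \<Rightarrow> ('v \<Rightarrow> 'v) \<Rightarrow> bool" where
  one: "pos (mat 1) id"
| S: "pos Smat s"
| minus_one: "pos (- mat 1) uminus"
| minus_S: "pos (- Smat) (\<lambda>x. - s x)"
| T: "pos g f \<Longrightarrow> pos (Tmat ** g) (\<lambda>x. s (r (f x)))"
| U: "pos g f \<Longrightarrow> pos (Umat ** g) (\<lambda>x. s (r (r (f x))))"

lemma pos_minus: "pos g f \<Longrightarrow> pos (- g) (\<lambda>x. - f x)"
proof (induction rule: pos.induct)
  case one then show ?case using pos.minus_one by (simp add: id_def)
next
  case S then show ?case by (rule pos.minus_S)
next
  case minus_one then show ?case using pos.one by (simp add: id_def)
next
  case minus_S then show ?case using pos.S by simp
next
  case (T g f)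
  have "- (Tmat ** g) = Tmat ** (- g)" by (simp add: vec_eq_iff matrix_matrix_mult_def sum_2)
  then show ?case using pos.T[OF T.IH] by (simp add: s_minus r_minus)
next
  case (U g f)
  have "- (Umat ** g) = Umat ** (- g)" by (simp add: vec_eq_iff matrix_matrix_mult_def sum_2)
  then show ?case using pos.U[OF U.IH] by (simp add: s_minus r_minus)
qed

text \<open>The two entries of a column never have opposite signs: adding one entry to the other
  preserves this, since \<open>(a + c) * c = a * c + c * c\<close>. This invariant separates
  nontrivial words from the identity.\<close>

lemma pos_columns: "pos g f \<Longrightarrow> g $ 1 $ 1 * g $ 2 $ 1 \<ge> 0 \<and> g $ 1 $ 2 * g $ 2 $ 2 \<ge> 0"
proof (induction rule: pos.induct)
  case (T g f)
  then show ?case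
    by (simp add: Tmat_eq_mat22 matrix_matrix_mult_def sum_2 distrib_right add_nonneg_nonneg)
next
  case (U g f)
  then show ?case
    by (simp add: Umat_def matrix_matrix_mult_def sum_2 distrib_left add_nonneg_nonneg)
qed (simp_all add: mat_1_eq_mat22 Smat_def)

lemma minus_one_mult: "- mat 1 ** g = - (g :: int ^ 2 ^ 2)"
  by (simp add: vec_eq_iff forall_2 mat_1_eq_mat22 matrix_matrix_mult_def sum_2)

lemma mult_minus: "(g :: int ^ 2 ^ 2) ** (- h) = - (g ** h)"
  by (simp add: vec_eq_iff matrix_matrix_mult_def sum_2)

text \<open>Prepending \<open>R\<close> raises the power of \<open>R\<close>, and its cube is a sign
  that \<open>pos_minus\<close> absorbs. Prepending \<open>S\<close> to a word starting with
  \<open>R\<close> creates a new factor \<open>T\<close> or \<open>U\<close>.\<close>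

lemma graph_normal_form:
  assumes "graph g f"
  shows "\<exists>h k. pos h k \<and> (g = h \<and> f = k \<or> g = Rmat ** h \<and> f = (\<lambda>x. r (k x)) \<or>
    g = Rmat ** (Rmat ** h) \<and> f = (\<lambda>x. r (r (k x))))"
  using assms
proof (induction rule: graph.induct)
  case one
  then show ?case using pos.one by blast
next
  case (R g f)
  then obtain h k where hk: "pos h k" and "g = h \<and> f = k \<or> g = Rmat ** h \<and> f = (\<lambda>x. r (k x)) \<or>
    g = Rmat ** (Rmat ** h) \<and> f = (\<lambda>x. r (r (k x)))" by blast
  then consider "g = h" "f = k" | "g = Rmat ** h" "f = (\<lambda>x. r (k x))"
    | "g = Rmat ** (Rmat ** h)" "f = (\<lambda>x. r (r (k x)))" by blast
  then show ?case
  proof cases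
    case 3
    then have "Rmat ** g = - h" "r \<circ> f = (\<lambda>x. - k x)"
      using gens_rels(2) by (simp_all add: matrix_mul_assoc minus_one_mult fun_eq_iff r_r_r)
    then show ?thesis using pos_minus[OF hk] by blast
  qed (use hk in \<open>auto simp: comp_def\<close>)
next
  case (S g f)
  then obtain h k where hk: "pos h k" and "g = h \<and> f = k \<or> g = Rmat ** h \<and> f = (\<lambda>x. r (k x)) \<or>
    g = Rmat ** (Rmat ** h) \<and> f = (\<lambda>x. r (r (k x)))" by blast
  then consider "g = h" "f = k" | "g = Rmat ** h" "f = (\<lambda>x. r (k x))"
    | "g = Rmat ** (Rmat ** h)" "f = (\<lambda>x. r (r (k x)))" by blast
  then show ?case
  proof cases
    case 2
    then have "Smat ** g = Tmat ** h" "s \<circ> f = (\<lambda>x. s (r (k x)))"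
      using gens_rels(3) by (simp_all add: matrix_mul_assoc fun_eq_iff)
    then show ?thesis using pos.T[OF hk] by auto
  next
    case 3
    then have "Smat ** g = Umat ** h" "s \<circ> f = (\<lambda>x. s (r (r (k x))))"
      using gens_rels(4) by (simp_all add: matrix_mul_assoc fun_eq_iff)
    then show ?thesis using pos.U[OF hk] by auto
  next
    \<comment> \<open>With no power of \<open>R\<close> in front, \<open>S\<close> cancels against
      the leading \<open>S\<close> of the word: \<open>S T = - R\<close> and
      \<open>S U = - R R\<close>.\<close>
    case 1
    have SS: "Smat ** (Smat ** h') = - h'" for h' :: "int ^ 2 ^ 2"
      using gens_rels(1) by (simp add: matrix_mul_assoc minus_one_mult)
    have "\<exists>h' k'. pos h' k' \<and> (Smat ** h = h' \<and> s \<circ> k = k' \<or>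
        Smat ** h = Rmat ** h' \<and> s \<circ> k = (\<lambda>x. r (k' x)) \<or>
        Smat ** h = Rmat ** (Rmat ** h') \<and> s \<circ> k = (\<lambda>x. r (r (k' x))))"
      using hk
    proof (cases rule: pos.cases)
      case one
      then show ?thesis using pos.S by auto
    next
      case S
      then have "Smat ** h = - mat 1" "s \<circ> k = uminus" by (simp_all add: gens_rels fun_eq_iff s_s)
      then show ?thesis using pos.minus_one by metis
    next
      case minus_one
      then have "Smat ** h = - Smat" "s \<circ> k = (\<lambda>x. - s x)" by (simp_all add: mult_minus fun_eq_iff s_minus)
      then show ?thesis using pos.minus_S by metis
    next
      case minus_S
      then have "Smat ** h = mat 1" "s \<circ> k = id" by (simp_all add: mult_minus gens_rels fun_eq_iff s_minus s_s)
      then show ?thesis using pos.one by metis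
    next
      case (T h' k')
      then have "Smat ** h = Rmat ** (- h')" "s \<circ> k = (\<lambda>x. r (- k' x))"
        by (simp_all add: SS mult_minus fun_eq_iff r_minus s_s flip: matrix_mul_assoc gens_rels(3))
      then show ?thesis using pos_minus[OF T(3)] by blast
    next
      case (U h' k')
      then have "Smat ** h = Rmat ** (Rmat ** (- h'))" "s \<circ> k = (\<lambda>x. r (r (- k' x)))"
        by (simp_all add: SS mult_minus fun_eq_iff r_minus s_s flip: matrix_mul_assoc gens_rels(4))
      then show ?thesis using pos_minus[OF U(3)] by blast
    qed
    then show ?thesis unfolding 1 .
  qed
qed

lemma pos_one:
  assumes "pos (mat 1) f"
  shows "f = id"
proof -
  \<comment> \<open>Here \<open>h\<close> would be the inverse of \<open>Tmat\<close> or
    \<open>Umat\<close>, which has a column with entries 1 and -1, against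
    \<open>pos_columns\<close>.\<close>
  have no: False if h: "pos h k" "X ** h = mat 1" "X = Tmat \<or> X = Umat" for X h k
  proof -
    have "h = mat22 (h $ 1 $ 1) (h $ 1 $ 2) (h $ 2 $ 1) (h $ 2 $ 2)" by (rule mat22_eta)
    then obtain a b c d where habcd: "h = mat22 a b c d" by blast
    then show False
      using pos_columns[OF h(1)] h(2,3) by (auto simp: mat22_defs)
  qed
  show ?thesis
    using assms
  proof (cases rule: pos.cases)
    case (T g f)
    then show ?thesis using no by metis
  next
    case (U g f)
    then show ?thesis using no by metis
  qed (auto simp: mat22_defs)
qed

lemma graph_one:
  assumes "graph (mat 1) f"
  shows "f = id"
proof -
  obtain h k where hk: "pos h k" and *: "mat 1 = h \<and> f = k \<or> mat 1 = Rmat ** h \<and> f = (\<lambda>x. r (k x)) \<or>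
    mat 1 = Rmat ** (Rmat ** h) \<and> f = (\<lambda>x. r (r (k x)))"
    using graph_normal_form[OF assms] by blast
  have "h = mat22 (h $ 1 $ 1) (h $ 1 $ 2) (h $ 2 $ 1) (h $ 2 $ 2)" by (rule mat22_eta)
  then obtain a b c d where habcd: "h = mat22 a b c d" by blast
  \<comment> \<open>The inverses of \<open>Rmat\<close> and of its square also have a column with
    entries of opposite signs.\<close>
  then have "mat 1 \<noteq> Rmat ** h" "mat 1 \<noteq> Rmat ** (Rmat ** h)"
    using pos_columns[OF hk] by (auto simp: mat22_defs)
  then show ?thesis using * hk pos_one by blast
qed

text \<open>Both operators are inverse to one operator \<open>k\<close> belonging to the inverse
  matrix, so the case of the identity matrix is enough.\<close>

lemma graph_unique:
  assumes "g \<in> SL2Z" "graph g f" "graph g f'"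
  shows "f = f'"
proof -
  obtain h where h: "h \<in> SL2Z" "g ** h = mat 1" "h ** g = mat 1"
    using SL2Z_inverse[OF assms(1)] .
  obtain k where k: "graph h k" using graph_total[OF h(1)] by blast
  have "f \<circ> k = id" "k \<circ> f' = id"
    using graph_mult[OF assms(2) k] graph_mult[OF k assms(3)] h graph_one by auto
  then show ?thesis by (metis comp_assoc comp_id id_comp)
qed

definition rep :: "int ^ 2 ^ 2 \<Rightarrow> 'v \<Rightarrow> 'v" where
  "rep g = (THE f. graph g f)"

lemma graph_rep: "g \<in> SL2Z \<Longrightarrow> graph g (rep g)"
  unfolding rep_def by (metis graph_total graph_unique theI')

lemma rep_eqI: "g \<in> SL2Z \<Longrightarrow> graph g f \<Longrightarrow> rep g = f"
  using graph_rep graph_unique by blast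

lemma rep_one: "rep (mat 1) = id"
  by (rule rep_eqI[OF _ graph.one]) simp

lemma rep_mult: "g \<in> SL2Z \<Longrightarrow> h \<in> SL2Z \<Longrightarrow> rep (g ** h) = rep g \<circ> rep h"
  by (rule rep_eqI[OF SL2Z_mult graph_mult[OF graph_rep graph_rep]])

lemma rep_S: "rep Smat = s"
  using rep_eqI[OF _ graph.S[OF graph.one]] by simp

lemma rep_R: "rep Rmat = r"
  using rep_eqI[OF _ graph.R[OF graph.one]] by simp

end

section \<open>Indecomposability criterion\<close>

lemma CG_module_additive:
  assumes "CG_module smul rho" "g \<in> SL2Z"
  shows "rho g (x + y) = rho g x + rho g y" "rho g (smul c x) = smul c (rho g x)"
  using assms by (auto simp: CG_module_def Vector_Spaces.linear_iff)

text \<open>The last nonzero iterate of \<open>T - 1\<close> on any nonzero vector of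
  \<open>A\<close> is fixed by \<open>T\<close> and stays in \<open>A\<close>.\<close>

lemma T_invariant_meets_kernel:
  assumes "vector_space smul" "T_invariant smul rho A" "A \<noteq> {0}"
    and unip: "\<And>x. \<exists>n. ((\<lambda>x. rho Tmat x - x) ^^ n) x = 0"
  obtains x where "x \<in> A" "x \<noteq> 0" "rho Tmat x = x"
proof -
  interpret vector_space smul by fact
  let ?N = "\<lambda>x. rho Tmat x - x"
  have A: "subspace A" "\<And>x. x \<in> A \<Longrightarrow> rho Tmat x \<in> A"
    using assms(2) by (auto simp: T_invariant_def)
  obtain x where x: "x \<in> A" "x \<noteq> 0"
    using assms(3) subspace_0[OF A(1)] by blast
  define n where "n = (LEAST n. (?N ^^ n) x = 0)"
  have n: "(?N ^^ n) x = 0"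
    unfolding n_def by (rule LeastI_ex) (rule unip)
  then obtain m where m: "n = Suc m" using x by (cases n) auto
  have "(?N ^^ m) x \<noteq> 0"
    using not_less_Least[of m "\<lambda>n. (?N ^^ n) x = 0"] m n_def by auto
  moreover have "(?N ^^ k) x \<in> A" for k
    by (induction k) (auto simp: x A subspace_diff)
  moreover have "rho Tmat ((?N ^^ m) x) = (?N ^^ m) x" using n m by simp
  ultimately show thesis using that by blast
qed

text \<open>If the fixed vectors of \<open>T\<close> lie on one line, every nonzero invariant
  subspace contains that line, so no two of them intersect trivially.\<close>

lemma T_indecomposableI:
  assumes "vector_space smul"
    and unip: "\<And>x. \<exists>n. ((\<lambda>x. rho Tmat x - x) ^^ n) x = 0"
    and ker: "\<And>x. rho Tmat x = x \<Longrightarrow> \<exists>c. x = smul c e"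
  shows "T_indecomposable smul rho"
proof -
  interpret vector_space smul by fact
  have e: "e \<in> A \<and> e \<noteq> 0" if A: "T_invariant smul rho A" "A \<noteq> {0}" for A
  proof -
    obtain x where x: "x \<in> A" "x \<noteq> 0" "rho Tmat x = x"
      using T_invariant_meets_kernel[OF assms(1) A unip] .
    then obtain c where c: "x = smul c e" using ker by blast
    have "subspace A" using A by (simp add: T_invariant_def)
    then have "smul (inverse c) x \<in> A" using x(1) by (rule subspace_scale)
    then show ?thesis using c x(2) by auto
  qed
  show ?thesis
    unfolding T_indecomposable_def T_acts_indecomposably_def T_acts_unipotently_def
    using unip e by blast
qed

text \<open>Two independent fixed vectors would span an invariant plane that splits into two
  invariant lines.\<close>

lemma T_indecomposable_kernel:
  assumes "CG_module smul rho" "T_indecomposable smul rho"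
    and "rho Tmat e = e" "e \<noteq> 0" "rho Tmat x = x"
  obtains c where "x = smul c e"
proof (rule ccontr)
  assume "\<not> thesis"
  with that have no: "x \<noteq> smul c e" for c by blast
  interpret vector_space smul using assms(1) by (simp add: CG_module_def)
  have T: "rho Tmat (y + z) = rho Tmat y + rho Tmat z" "rho Tmat (smul c y) = smul c (rho Tmat y)" for y z c
    using CG_module_additive[OF assms(1)] by auto
  let ?A = "span {e}" and ?B = "span {x}"
  have fixed: "y \<in> ?A \<Longrightarrow> rho Tmat y = y" "y \<in> ?B \<Longrightarrow> rho Tmat y = y" for y
    by (auto simp: span_singleton T assms)
  have inv: "T_invariant smul rho ?A" "T_invariant smul rho ?B"
    unfolding T_invariant_def by (auto simp: fixed)
  have "e \<in> ?A" "x \<in> ?B" by (simp_all add: span_base)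
  have "x \<noteq> 0" using no[of 0] by simp
  have "?A \<inter> ?B = {0}"
  proof -
    have "y = 0" if "y \<in> ?A" "y \<in> ?B" for y
    proof (rule ccontr)
      assume "y \<noteq> 0"
      have "\<exists>c. y = smul c e" "\<exists>d. y = smul d x"
        using that by (auto simp: span_singleton)
      then obtain c d where cd: "y = smul c e" "y = smul d x" by blast
      from cd(2) have "x = smul (inverse d) y" using \<open>y \<noteq> 0\<close> by (cases "d = 0") simp_all
      then show False using cd(1) no[of "inverse d * c"] by simp
    qed
    then show ?thesis using span_zero by blast
  qed
  moreover have "?A \<noteq> {0}" "?B \<noteq> {0}"
    using \<open>e \<in> ?A\<close> \<open>x \<in> ?B\<close> assms(4) \<open>x \<noteq> 0\<close> by blast+
  moreover have "T_invariant smul rho {a + b | a b. a \<in> ?A \<and> b \<in> ?B}"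
    unfolding T_invariant_def
  proof
    show "subspace {a + b | a b. a \<in> ?A \<and> b \<in> ?B}"
      by (intro subspace_sums subspace_span)
    show "rho Tmat ` {a + b | a b. a \<in> ?A \<and> b \<in> ?B} \<subseteq> {a + b | a b. a \<in> ?A \<and> b \<in> ?B}"
      by (force simp: T fixed)
  qed
  ultimately show False
    using assms(2) inv unfolding T_indecomposable_def T_acts_indecomposably_def by blast
qed

section \<open>The model module on polynomials\<close>

definition ev :: "'a::zero poly \<Rightarrow> 'a poly" where
  "ev p = Abs_poly (\<lambda>i. coeff p (2 * i))"

definition od :: "'a::zero poly \<Rightarrow> 'a poly" where
  "od p = Abs_poly (\<lambda>i. coeff p (2 * i + 1))"

text \<open>Identifies pairs of polynomials with single ones, so that the module with two generators
  lives on the type \<open>complex poly\<close>.\<close>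

definition weave :: "'a::zero poly \<Rightarrow> 'a poly \<Rightarrow> 'a poly" where
  "weave a b = Abs_poly (\<lambda>i. if even i then coeff a (i div 2) else coeff b (i div 2))"

lemma coeff_ev [simp]: "coeff (ev p) i = coeff p (2 * i)"
  unfolding ev_def by (subst coeff_Abs_poly[where n = "degree p"]) (auto intro: coeff_eq_0)

lemma coeff_od [simp]: "coeff (od p) i = coeff p (Suc (2 * i))"
  unfolding od_def by (subst coeff_Abs_poly[where n = "degree p"]) (auto intro: coeff_eq_0)

lemma coeff_weave:
  "coeff (weave a b) i = (if even i then coeff a (i div 2) else coeff b (i div 2))"
  unfolding weave_def
  by (subst coeff_Abs_poly[where n = "2 * degree a + 2 * degree b + 1"]) (auto intro!: coeff_eq_0)

lemma ev_weave [simp]: "ev (weave a b) = a" and od_weave [simp]: "od (weave a b) = b"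
  by (simp_all add: poly_eq_iff coeff_weave)

lemma weave_ev_od [simp]: "weave (ev p) (od p) = p"
  by (simp add: poly_eq_iff coeff_weave)

lemma ev_od_eqI: "ev p = ev q \<Longrightarrow> od p = od q \<Longrightarrow> p = q"
  by (metis weave_ev_od)

lemma ev_od_simps [simp]:
  "ev 0 = 0" "od 0 = 0"
  "ev (p + q) = ev p + ev q" "od (p + q) = od p + od q"
  "ev (r - s) = ev r - ev s" "od (r - s) = od r - od s"
  "ev (- r) = - ev r" "od (- r) = - od r"
  "ev (smult c t) = smult c (ev t)" "od (smult c t) = smult c (od t)"
  for p q :: "'a::comm_monoid_add poly" and r s :: "'b::ab_group_add poly"
    and t :: "'c::comm_semiring_0 poly"
  by (simp_all add: poly_eq_iff)

lemma poly_shift_simps [simp]: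
  "poly_shift n (p + q) = poly_shift n p + poly_shift n q"
  "poly_shift n (r - s) = poly_shift n r - poly_shift n s"
  "poly_shift n (- r) = - poly_shift n r"
  "poly_shift n (smult c t) = smult c (poly_shift n t)"
  for p q :: "'a::comm_monoid_add poly" and r s :: "'b::ab_group_add poly"
    and t :: "'c::comm_semiring_0 poly"
  by (simp_all add: poly_eq_iff coeff_poly_shift)

definition omega :: complex where "omega = Complex (1 / 2) (sqrt 3 / 2)"

lemma omega_omega: "omega * omega = omega - 1"
  by (simp add: omega_def complex_eq_iff)

text \<open>The right-nested form of \<open>omega_omega\<close>, which lets the simplifier lower
  powers of \<open>omega\<close> inside products.\<close>

lemma omega_omega_mult: "omega * (omega * z) = omega * z - z"
  using omega_omega by (metis left_diff_distrib mult.assoc mult_1)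

lemma omega_nonzero: "omega \<noteq> 0" and two_omega_neq_1: "2 * omega \<noteq> 1"
  by (simp_all add: omega_def complex_eq_iff)

text \<open>The module is \<open>\<complex>[d]\<close>-cofree on two generators, where \<open>d\<close> lowers the degree; \<open>R\<close> and \<open>S\<close>
  are the matrices with rows \<open>(\<omega>, 2 + d), (0, 1 - \<omega>)\<close> and \<open>(0, -1), (1, 0)\<close>, so that
  \<open>S R + (S R)\<^sup>-\<^sup>1 = 2 + d\<close>.\<close>
definition model_S :: "complex poly \<Rightarrow> complex poly" where
  "model_S p = weave (- od p) (ev p)"

definition model_R :: "complex poly \<Rightarrow> complex poly" where
  "model_R p = weave (smult omega (ev p) + smult 2 (od p) + poly_shift 1 (od p)) (smult (1 - omega) (od p))"

lemma ev_od_model [simp]: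
  "ev (model_S p) = - od p" "od (model_S p) = ev p"
  "ev (model_R p) = smult omega (ev p) + smult 2 (od p) + poly_shift 1 (od p)"
  "od (model_R p) = smult (1 - omega) (od p)"
  by (simp_all add: model_S_def model_R_def)

lemma vector_space_smult: "vector_space (smult :: 'a::field \<Rightarrow> _)"
  by unfold_locales (simp_all add: smult_add_right smult_add_left)

lemma linear_model:
  "Vector_Spaces.linear smult smult model_S" "Vector_Spaces.linear smult smult model_R"
proof -
  have "model_S (p + q) = model_S p + model_S q" "model_R (p + q) = model_R p + model_R q"
    "model_S (smult c p) = smult c (model_S p)" "model_R (smult c p) = smult c (model_R p)" for p q c
    by (rule ev_od_eqI; simp add: smult_add_right mult.commute)+
  then show "Vector_Spaces.linear smult smult model_S" "Vector_Spaces.linear smult smult model_R"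
    by (simp_all add: Vector_Spaces.linear_iff vector_space_smult)
qed

text \<open>This is Cayley-Hamilton: the triangular matrix of \<open>model_R\<close> has trace 1 and
  determinant \<open>omega * (1 - omega) = 1\<close>.\<close>

lemma model_R_R: "model_R (model_R p) = model_R p - p"
  by (rule ev_od_eqI)
    (auto simp: poly_eq_iff coeff_poly_shift algebra_simps omega_omega omega_omega_mult)

interpretation model: SL2Z_relations model_S model_R
proof
  interpret S: Vector_Spaces.linear smult smult model_S by (rule linear_model)
  interpret R: Vector_Spaces.linear smult smult model_R by (rule linear_model)
  show "model_S (model_S x) = - x" for x
    by (rule ev_od_eqI) auto
  show "model_R (model_R (model_R x)) = - x" for x
    by (simp add: model_R_R R.diff)
  show "model_S (- x) = - model_S x" "model_R (- x) = - model_R x" for x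
    by (rule S.neg R.neg)+
qed

abbreviation "model_rep \<equiv> model.rep"

lemma model_T: "model_rep Tmat p = model_S (model_R p)"
  using model.rep_mult[of Smat Rmat] by (simp add: gens_rels model.rep_S model.rep_R)

lemma CG_module_model: "CG_module smult model_rep"
proof -
  have "Vector_Spaces.linear smult smult (model_rep g)" if "g \<in> SL2Z" for g
    using that
  proof (induction rule: SL2Z_induct)
    case one
    show ?case by (simp add: model.rep_one Vector_Spaces.linear_iff vector_space_smult)
  next
    case (S g)
    then show ?case using linear_model(1)
      by (auto simp: model.rep_mult model.rep_S Vector_Spaces.linear_iff)
  next
    case (R g)
    then show ?case using linear_model(2)
      by (auto simp: model.rep_mult model.rep_R Vector_Spaces.linear_iff)
  qed
  then show ?thesis
    by (simp add: CG_module_def vector_space_smult model.rep_one model.rep_mult)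
qed

section \<open>Filtration and indecomposability of the model\<close>

definition model_F :: "nat \<Rightarrow> complex poly set" where
  "model_F n = {p. \<forall>k\<ge>n. coeff (ev p) k = 0 \<and> coeff (od p) k = 0}"

text \<open>The operator \<open>d\<close> acting on both components; on the model it plays the role
  of \<open>T + T^-1 - 2\<close>.\<close>

definition model_shift :: "complex poly \<Rightarrow> complex poly" where
  "model_shift p = weave (poly_shift 1 (ev p)) (poly_shift 1 (od p))"

lemma ev_od_model_shift [simp]:
  "ev (model_shift p) = poly_shift 1 (ev p)" "od (model_shift p) = poly_shift 1 (od p)"
  by (simp_all add: model_shift_def)

lemma model_F_0: "model_F 0 = {0}"
proof -
  have "p = 0" if "p \<in> model_F 0" for p
    by (rule ev_od_eqI) (use that in \<open>simp_all add: model_F_def poly_eq_iff del: coeff_ev coeff_od\<close>)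
  then show ?thesis by (auto simp: model_F_def)
qed

lemma model_F_Un: "(\<Union>n. model_F n) = UNIV"
proof -
  have "p \<in> model_F (Suc (degree p))" for p
    by (auto simp: model_F_def intro!: coeff_eq_0)
  then show ?thesis by blast
qed

lemma model_F_SR: "p \<in> model_F n \<Longrightarrow> model_S p \<in> model_F n \<and> model_R p \<in> model_F n"
  by (simp add: model_F_def coeff_poly_shift del: coeff_ev coeff_od)

lemma model_F_shift: "p \<in> model_F (Suc n) \<Longrightarrow> model_shift p \<in> model_F n"
  by (simp add: model_F_def coeff_poly_shift del: coeff_ev coeff_od)

lemma CG_submodule_model_F: "CG_submodule smult model_rep (model_F n)"
proof -
  interpret vector_space "smult :: complex \<Rightarrow> _" by (rule vector_space_smult)
  have "model_rep g p \<in> model_F n" if "g \<in> SL2Z" "p \<in> model_F n" for g p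
    using that
    by (induction rule: SL2Z_induct)
      (auto simp: model.rep_one model.rep_mult model.rep_S model.rep_R model_F_SR)
  moreover have "subspace (model_F n)"
    by (auto simp: subspace_def model_F_def)
  ultimately show ?thesis by (auto simp: CG_submodule_def)
qed

lemma std_action_mult: "std_action (g ** h) v = std_action g (std_action h v)"
  by (simp add: std_action_def vec_eq_iff forall_2 matrix_vector_mult_def matrix_matrix_mult_def sum_2 algebra_simps)

lemma std_action_gens:
  "std_action (mat 1) v = v"
  "std_action Smat v = vector [v $ 2, - v $ 1]"
  "std_action Rmat v = vector [- v $ 2, v $ 1 + v $ 2]"
  "std_action Tmat v = vector [v $ 1 + v $ 2, v $ 2]"
  by (simp_all add: std_action_def mat22_defs vec_eq_iff forall_2 matrix_vector_mult_def sum_2)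

lemma quotient_iso_std_model_F: "quotient_iso_std smult model_rep (model_F (Suc n)) (model_F n)"
proof -
  \<comment> \<open>The leading coefficients are read in the basis \<open>(1, -omega)\<close>, the
    \<open>omega\<close>-eigenvector of \<open>Rmat\<close> in V, and its image
    \<open>(-omega, -1)\<close> under \<open>Smat\<close>.\<close>
  define \<phi> :: "complex poly \<Rightarrow> complex ^ 2" where
    "\<phi> p = vector [coeff (ev p) n - omega * coeff (od p) n, - omega * coeff (ev p) n - coeff (od p) n]" for p
  have \<phi>SR: "\<phi> (model_S p) = std_action Smat (\<phi> p)" "\<phi> (model_R p) = std_action Rmat (\<phi> p)"
    if "p \<in> model_F (Suc n)" for p
    using that
    by (auto simp: \<phi>_def std_action_gens vec_eq_iff forall_2 model_F_def coeff_poly_shift algebra_simps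
        omega_omega_mult simp del: coeff_ev coeff_od)
  have equiv: "\<phi> (model_rep g p) = std_action g (\<phi> p)" if "g \<in> SL2Z" "p \<in> model_F (Suc n)" for g p
    using that
  proof (induction rule: SL2Z_induct)
    case one
    then show ?case by (simp add: model.rep_one std_action_gens)
  next
    case (S g)
    moreover have "model_rep g p \<in> model_F (Suc n)"
      using S CG_submodule_model_F by (auto simp: CG_submodule_def)
    ultimately show ?case by (simp add: model.rep_mult model.rep_S std_action_mult \<phi>SR)
  next
    case (R g)
    moreover have "model_rep g p \<in> model_F (Suc n)"
      using R CG_submodule_model_F by (auto simp: CG_submodule_def)
    ultimately show ?case by (simp add: model.rep_mult model.rep_R std_action_mult \<phi>SR)
  qed
  have surj: "\<exists>p\<in>model_F (Suc n). \<phi> p = v" for v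
  proof -
    \<comment> \<open>Solves the two linear equations; the division is by
      \<open>1 + omega * omega = omega\<close>.\<close>
    define a where "a = (v $ 1 - omega * v $ 2) / omega"
    define b where "b = - v $ 2 - omega * a"
    have "a - omega * b = v $ 1" "- omega * a - b = v $ 2"
      using omega_nonzero omega_omega by (simp_all add: b_def a_def field_simps omega_omega_mult)
    moreover have "weave (monom a n) (monom b n) \<in> model_F (Suc n)"
      by (auto simp: model_F_def simp del: coeff_ev coeff_od)
    ultimately show ?thesis
      by (intro bexI[of _ "weave (monom a n) (monom b n)"])
        (auto simp: \<phi>_def vec_eq_iff forall_2 simp del: coeff_ev coeff_od)
  qed
  have ker: "\<phi> p = 0 \<longleftrightarrow> coeff (ev p) n = 0 \<and> coeff (od p) n = 0" for p
  proof
    let ?a = "coeff (ev p) n" and ?b = "coeff (od p) n"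
    assume "\<phi> p = 0"
    moreover have "\<phi> p $ 1 = ?a - omega * ?b" "\<phi> p $ 2 = - omega * ?a - ?b"
      by (simp_all add: \<phi>_def)
    ultimately have 1: "?a - omega * ?b = 0" and 2: "- omega * ?a - ?b = 0"
      by (simp_all del: coeff_ev coeff_od)
    from 1 have a: "?a = omega * ?b" by (simp del: coeff_ev coeff_od)
    from 2 have "omega * ?b = 0"
      unfolding a by (simp add: omega_omega_mult del: coeff_ev coeff_od)
    then show "?a = 0 \<and> ?b = 0" using a omega_nonzero by simp
  qed (simp add: \<phi>_def vec_eq_iff forall_2)
  show ?thesis
    unfolding quotient_iso_std_def
  proof (intro exI[of _ \<phi>] conjI)
    have le: "n \<le> k \<longleftrightarrow> k = n \<or> Suc n \<le> k" for k by auto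
    show "{x \<in> model_F (Suc n). \<phi> x = 0} = model_F n"
      by (auto simp: ker model_F_def le simp del: coeff_ev coeff_od)
    show "\<phi> ` model_F (Suc n) = UNIV" by (metis UNIV_eq_I image_eqI surj)
  qed (auto simp: equiv, auto simp: \<phi>_def vec_eq_iff forall_2 algebra_simps)
qed

lemma good_filtration_model: "good_filtration smult model_rep model_F"
  unfolding good_filtration_def
  using model_F_0 model_F_Un CG_submodule_model_F quotient_iso_std_model_F
  by (auto simp: model_F_def)

lemma T_indecomposable_model: "T_indecomposable smult model_rep"
proof (rule T_indecomposableI[OF vector_space_smult])
  let ?N = "\<lambda>x. model_rep Tmat x - x"
  \<comment> \<open>This is \<open>(T - 1)^2 = T Z\<close> with \<open>Z\<close> the degree shift,
    so two factors \<open>T - 1\<close> descend one step of the filtration.\<close>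
  have N2: "?N (?N p) = model_S (model_R (model_shift p))" for p
    by (rule ev_od_eqI)
      (simp_all only: model_T ev_od_simps ev_od_model ev_od_model_shift poly_shift_simps poly_eq_iff
        coeff_add coeff_diff coeff_minus coeff_smult coeff_poly_shift,
       simp_all add: algebra_simps omega_omega omega_omega_mult del: coeff_ev coeff_od)
  have "(?N ^^ (2 * n)) p = 0" if "p \<in> model_F n" for n p
    using that
  proof (induction n arbitrary: p)
    case 0
    then show ?case by (simp add: model_F_0)
  next
    case (Suc n)
    \<comment> \<open>The two factors are split off at the inner end, where \<open>N2\<close>
      applies.\<close>
    have "(f ^^ (2 * Suc n)) p = (f ^^ (2 * n)) (f (f p))" for f :: "complex poly \<Rightarrow> _"
      by (simp add: funpow_swap1)
    note this[of ?N]
    then show ?case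
      using Suc by (simp only: N2 model_F_SR model_F_shift)
  qed
  then show "\<exists>n. (?N ^^ n) p = 0" for p
    using model_F_Un by blast
  \<comment> \<open>The constant pair \<open>(omega - 1, 1)\<close> corresponds to
    \<open>(-1, 0)\<close> in V, which spans the fixed line of \<open>Tmat\<close> there. Comparing
    components of \<open>T p = p\<close> forces the odd part to be constant.\<close>
  show "\<exists>c. p = smult c (weave [:omega - 1:] [:1:])" if "model_rep Tmat p = p" for p
  proof -
    have eo: "ev (model_S (model_R p)) = ev p" "od (model_S (model_R p)) = od p"
      using that by (simp_all add: model_T)
    have 1: "coeff (ev p) k = (omega - 1) * coeff (od p) k" for k
      using arg_cong[OF eo(1), of "\<lambda>q. coeff q k"] by (simp add: algebra_simps del: coeff_ev coeff_od)
    have "coeff (od p) (Suc k) = 0" for k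
      using arg_cong[OF eo(2), of "\<lambda>q. coeff q k"] 1[of k]
      by (simp add: coeff_poly_shift algebra_simps omega_omega omega_omega_mult del: coeff_ev coeff_od)
    then have 2: "coeff (od p) k = 0" if "k \<noteq> 0" for k
      using that by (metis not0_implies_Suc)
    have "p = smult (coeff (od p) 0) (weave [:omega - 1:] [:1:])"
      by (rule ev_od_eqI)
        (auto simp: poly_eq_iff coeff_pCons 1 2 split: nat.split simp del: coeff_ev coeff_od)
    then show ?thesis ..
  qed
qed

section \<open>Uniqueness\<close>

lemma std_action_minus_one: "std_action (- mat 1) v = - v"
  by (simp add: std_action_def mat22_defs vec_eq_iff forall_2 matrix_vector_mult_def sum_2)

text \<open>From any nonzero vector one reaches the first basis vector, by scaling or through
  \<open>T - 1\<close>; its image under \<open>Smat\<close> then completes a basis.\<close>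

lemma std_irreducible:
  assumes add: "\<And>v w. v \<in> X \<Longrightarrow> w \<in> X \<Longrightarrow> v + w \<in> X" and scale: "\<And>c v. v \<in> X \<Longrightarrow> c *s v \<in> X"
    and S: "\<And>v. v \<in> X \<Longrightarrow> std_action Smat v \<in> X" and R: "\<And>v. v \<in> X \<Longrightarrow> std_action Rmat v \<in> X"
    and v: "v \<in> X" "v \<noteq> 0"
  shows "x \<in> X"
proof -
  have e1: "vector [1, 0] \<in> X"
  proof (cases "v $ 2 = 0")
    case True
    then have "vector [1, 0] = inverse (v $ 1) *s v"
      using v(2) by (auto simp: vec_eq_iff forall_2)
    then show ?thesis using scale[OF v(1)] by simp
  next
    case False
    then have "vector [1, 0] = inverse (v $ 2) *s (std_action Smat (std_action Rmat v) + (-1) *s v)"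
      by (simp add: vec_eq_iff forall_2 std_action_gens field_simps)
    moreover have "inverse (v $ 2) *s (std_action Smat (std_action Rmat v) + (-1) *s v) \<in> X"
      by (intro scale add S R v)
    ultimately show ?thesis by simp
  qed
  have "x = x $ 1 *s vector [1, 0] + (- x $ 2) *s std_action Smat (vector [1, 0])"
    by (simp add: vec_eq_iff forall_2 std_action_gens)
  moreover have "x $ 1 *s vector [1, 0] + (- x $ 2) *s std_action Smat (vector [1, 0]) \<in> X"
    by (intro scale add S e1)
  ultimately show ?thesis by simp
qed

section \<open>Relations forced on every filtered module\<close>

locale std_filtered_module = vector_space smul
  for smul :: "complex \<Rightarrow> 'v::ab_group_add \<Rightarrow> 'v" +
  fixes rho :: "int ^ 2 ^ 2 \<Rightarrow> 'v \<Rightarrow> 'v" and F :: "nat \<Rightarrow> 'v set"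
  assumes CG: "CG_module smul rho"
    and indec: "T_indecomposable smul rho"
    and filt: "good_filtration smul rho F"
begin

abbreviation "S \<equiv> rho Smat"
abbreviation "R \<equiv> rho Rmat"
abbreviation "T \<equiv> rho Tmat"

lemma rho_add [simp]: "g \<in> SL2Z \<Longrightarrow> rho g (x + y) = rho g x + rho g y"
  and rho_scale [simp]: "g \<in> SL2Z \<Longrightarrow> rho g (smul c x) = smul c (rho g x)"
  using CG_module_additive[OF CG] by auto

lemma rho_zero [simp]: "g \<in> SL2Z \<Longrightarrow> rho g 0 = 0"
  using rho_scale[of g 0 0] by simp

lemma rho_minus [simp]: "g \<in> SL2Z \<Longrightarrow> rho g (- x) = - rho g x"
  using rho_scale[of g "- 1" x] by simp

lemma rho_diff [simp]: "g \<in> SL2Z \<Longrightarrow> rho g (x - y) = rho g x - rho g y"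
  using rho_add[of g x "- y"] by simp

lemma rho_mult: "g \<in> SL2Z \<Longrightarrow> h \<in> SL2Z \<Longrightarrow> rho (g ** h) x = rho g (rho h x)"
  using CG by (simp add: CG_module_def)

lemma rho_one: "rho (mat 1) x = x"
  using CG by (simp add: CG_module_def)

lemma F_0: "F 0 = {0}" and F_Suc: "x \<in> F n \<Longrightarrow> x \<in> F (Suc n)" and F_Un: "\<exists>n. x \<in> F n"
  using filt unfolding good_filtration_def by auto

lemma F_mono: "m \<le> n \<Longrightarrow> x \<in> F m \<Longrightarrow> x \<in> F n"
  by (induction n rule: dec_induct) (auto intro: F_Suc)

lemma F_subspace: "subspace (F n)"
  using filt by (auto simp: good_filtration_def CG_submodule_def)

lemma F_rho: "g \<in> SL2Z \<Longrightarrow> x \<in> F n \<Longrightarrow> rho g x \<in> F n"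
  using filt unfolding good_filtration_def CG_submodule_def by blast

lemmas F_closed = subspace_add[OF F_subspace] subspace_diff[OF F_subspace]
  subspace_scale[OF F_subspace] subspace_0[OF F_subspace] F_rho SL2Z_gens

text \<open>Fixes one projection onto V for each step of the filtration. Its values are meaningful
  only on \<open>F (Suc n)\<close>.\<close>

definition quot :: "nat \<Rightarrow> 'v \<Rightarrow> complex ^ 2" where
  "quot n = (SOME \<phi>. (\<forall>x\<in>F (Suc n). \<forall>y\<in>F (Suc n). \<phi> (x + y) = \<phi> x + \<phi> y) \<and>
    (\<forall>c. \<forall>x\<in>F (Suc n). \<phi> (smul c x) = c *s \<phi> x) \<and>
    \<phi> ` F (Suc n) = UNIV \<and>
    {x\<in>F (Suc n). \<phi> x = 0} = F n \<and>
    (\<forall>g\<in>SL2Z. \<forall>x\<in>F (Suc n). \<phi> (rho g x) = std_action g (\<phi> x)))"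

lemma quot_axioms:
  "(\<forall>x\<in>F (Suc n). \<forall>y\<in>F (Suc n). quot n (x + y) = quot n x + quot n y) \<and>
    (\<forall>c. \<forall>x\<in>F (Suc n). quot n (smul c x) = c *s quot n x) \<and>
    quot n ` F (Suc n) = UNIV \<and>
    {x\<in>F (Suc n). quot n x = 0} = F n \<and>
    (\<forall>g\<in>SL2Z. \<forall>x\<in>F (Suc n). quot n (rho g x) = std_action g (quot n x))"
proof -
  have "quotient_iso_std smul rho (F (Suc n)) (F n)"
    using filt by (simp add: good_filtration_def)
  then show ?thesis
    unfolding quot_def quotient_iso_std_def by (rule someI_ex)
qed

lemma quot_add: "x \<in> F (Suc n) \<Longrightarrow> y \<in> F (Suc n) \<Longrightarrow> quot n (x + y) = quot n x + quot n y"
  and quot_scale: "x \<in> F (Suc n) \<Longrightarrow> quot n (smul c x) = c *s quot n x"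
  and quot_eq_0_iff: "x \<in> F (Suc n) \<Longrightarrow> quot n x = 0 \<longleftrightarrow> x \<in> F n"
  and quot_rho: "g \<in> SL2Z \<Longrightarrow> x \<in> F (Suc n) \<Longrightarrow> quot n (rho g x) = std_action g (quot n x)"
proof -
  have "quot n x = 0 \<longleftrightarrow> x \<in> F n" if "x \<in> F (Suc n)"
  proof -
    have "{x \<in> F (Suc n). quot n x = 0} = F n" using quot_axioms[of n] by (elim conjE)
    then show ?thesis using that by auto
  qed
  then show "x \<in> F (Suc n) \<Longrightarrow> quot n x = 0 \<longleftrightarrow> x \<in> F n" .
qed (simp_all add: quot_axioms)

lemma quot_surj: obtains x where "x \<in> F (Suc n)" "quot n x = v"
proof -
  have "quot n ` F (Suc n) = UNIV" using quot_axioms[of n] by (elim conjE)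
  then have "v \<in> quot n ` F (Suc n)" by simp
  then show thesis using that by blast
qed

lemma quot_diff: "x \<in> F (Suc n) \<Longrightarrow> y \<in> F (Suc n) \<Longrightarrow> quot n (x - y) = quot n x - quot n y"
  using quot_add[of "x - y" n y] F_closed(2) by simp

lemma quot_0_inj: "x \<in> F (Suc 0) \<Longrightarrow> y \<in> F (Suc 0) \<Longrightarrow> quot 0 x = quot 0 y \<Longrightarrow> x = y"
  using quot_diff[of x 0 y] quot_eq_0_iff[of "x - y" 0] by (simp add: F_closed F_0)

lemmas quot_simps = quot_add quot_diff quot_scale quot_rho std_action_gens

text \<open>Descent along the filtration: each projection to V is an eigenvector for the same
  \<open>c\<close>, hence zero. This lifts identities from V to the whole module.\<close>

lemma eigenvector_zero:
  assumes g: "g \<in> SL2Z" and y: "rho g y = smul c y"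
    and V: "\<And>v :: complex ^ 2. std_action g v = c *s v \<Longrightarrow> v = 0"
  shows "y = 0"
proof -
  have "y = 0" if "y \<in> F n" for n
    using that
  proof (induction n)
    case 0
    then show ?case by (simp add: F_0)
  next
    case (Suc n)
    then show ?case
      using Suc g y V[of "quot n y"] quot_scale[of y n c] quot_rho[of g y n] quot_eq_0_iff[of y n] by simp
  qed
  then show ?thesis using F_Un by blast
qed

text \<open>The sum of \<open>x\<close> and its image is fixed by \<open>-1\<close>, whereas
  \<open>-1\<close> fixes no nonzero vector of V.\<close>

lemma minus_one: "rho (- mat 1) x = - x"
proof -
  let ?c = "rho (- mat 1)"
  have "?c (?c x) = x"
  proof -
    have "- mat 1 ** - mat 1 = (mat 1 :: int ^ 2 ^ 2)" by (simp add: mat_1_eq_mat22)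
    then show ?thesis using rho_mult[of "- mat 1" "- mat 1" x] by (simp add: rho_one)
  qed
  then have "?c x + x = 0"
    by (intro eigenvector_zero[of "- mat 1" _ 1])
      (auto simp: std_action_minus_one add.commute vec_eq_iff forall_2)
  then show ?thesis by (simp add: eq_neg_iff_add_eq_0)
qed

lemma S_S: "S (S x) = - x"
  using rho_mult[of Smat Smat x] by (simp add: gens_rels minus_one)

lemma R_R_R: "R (R (R x)) = - x"
  using rho_mult[of Rmat "Rmat ** Rmat" x] rho_mult[of Rmat Rmat x]
  by (simp add: gens_rels minus_one SL2Z_mult)

text \<open>Since \<open>(R + 1) (R^2 - R + 1) = R^3 + 1 = 0\<close>, the error term is an
  eigenvector for -1, which is not an eigenvalue of \<open>Rmat\<close> on V.\<close>

lemma R_R: "R (R x) = R x - x"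
proof -
  have "R (R x) - R x + x = 0"
  proof (rule eigenvector_zero[of Rmat _ "- 1"])
    show "R (R (R x) - R x + x) = smul (- 1) (R (R x) - R x + x)"
      by (simp add: R_R_R)
    show "v = 0" if "std_action Rmat v = - 1 *s v" for v :: "complex ^ 2"
      using that by (auto simp: std_action_gens vec_eq_iff forall_2)
  qed simp
  then show ?thesis by (simp add: algebra_simps eq_neg_iff_add_eq_0)
qed

lemma T_eq: "T x = S (R x)"
  using rho_mult[of Smat Rmat x] by (simp add: gens_rels)

section \<open>The central operator \<open>Z\<close>: its kernel and its image\<close>

text \<open>This is \<open>T + T\<^sup>-\<^sup>1 - 2\<close>, written with \<open>R\<^sup>-\<^sup>1 = 1 - R\<close> and \<open>S\<^sup>-\<^sup>1 = -S\<close>.\<close>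
definition Z :: "'v \<Rightarrow> 'v" where
  "Z x = S (R x) + R (S x) - S x - smul 2 x"

lemma Z_add [simp]: "Z (x + y) = Z x + Z y" and Z_diff [simp]: "Z (x - y) = Z x - Z y"
  and Z_scale [simp]: "Z (smul c x) = smul c (Z x)"
  by (simp_all add: Z_def algebra_simps)

lemma Z_zero [simp]: "Z 0 = 0"
  by (simp add: Z_def)

lemma Z_S: "Z (S x) = S (Z x)" and Z_R: "Z (R x) = R (Z x)"
  by (simp_all add: Z_def S_S R_R algebra_simps)

lemma T_Z: "T (Z x) = T (T x - x) - (T x - x)"
proof -
  have "smul 2 y = y + y" for y
    using scale_left_distrib[of 1 1 y] by simp
  then show ?thesis by (simp add: Z_def T_eq S_S R_R)
qed

text \<open>On V the matrix \<open>Tmat\<close> has trace 2 and determinant 1, so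
  \<open>T + T^-1 - 2\<close> vanishes on each quotient.\<close>

lemma Z_F:
  assumes "x \<in> F (Suc n)"
  shows "Z x \<in> F n"
proof -
  have "quot n (Z x) = 0"
    using assms unfolding Z_def
    by (simp add: quot_simps F_closed std_action_gens vec_eq_iff forall_2)
  then show ?thesis using assms quot_eq_0_iff[of "Z x" n] by (simp add: Z_def F_closed)
qed

text \<open>If \<open>Z x = 0\<close>, then \<open>(T - 1)^2 x = 0\<close>. As the kernel of
  \<open>T - 1\<close> is a line, the kernel of its square is spanned by a Jordan chain
  \<open>e\<close>, \<open>y\<close>, which already lies in \<open>F (Suc 0)\<close>.\<close>

lemma Z_eq_0_iff: "Z x = 0 \<longleftrightarrow> x \<in> F (Suc 0)"
proof
  show "Z x = 0" if "x \<in> F (Suc 0)"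
    using Z_F[of x 0] that by (simp add: F_0)
  assume "Z x = 0"
  obtain e where e: "e \<in> F (Suc 0)" "quot 0 e = vector [1, 0]" by (rule quot_surj)
  obtain y where y: "y \<in> F (Suc 0)" "quot 0 y = vector [0, 1]" by (rule quot_surj)
  note ey = e y
  have Te: "T e = e"
    by (rule quot_0_inj) (simp_all add: ey quot_simps F_closed std_action_gens vec_eq_iff forall_2)
  have Ty: "T y = y + e"
    by (rule quot_0_inj) (simp_all add: ey quot_simps F_closed std_action_gens vec_eq_iff forall_2)
  have "e \<noteq> 0"
    using ey(2) quot_scale[of e 0 0] ey(1) by (auto simp: vec_eq_iff forall_2)
  have "T (T x - x) = T x - x"
    using T_Z[of x] \<open>Z x = 0\<close> by simp
  then obtain c where c: "T x - x = smul c e"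
    using T_indecomposable_kernel[OF CG indec Te \<open>e \<noteq> 0\<close>] by metis
  have "T (x - smul c y) = x - smul c y"
    using c by (simp add: Ty algebra_simps)
  then obtain d where "x - smul c y = smul d e"
    using T_indecomposable_kernel[OF CG indec Te \<open>e \<noteq> 0\<close>] by metis
  then have "x = smul d e + smul c y" by (simp add: algebra_simps)
  then show "x \<in> F (Suc 0)" using ey by (simp add: F_closed)
qed

lemma Z_surj_F: "x \<in> F n \<Longrightarrow> \<exists>y\<in>F (Suc n). Z y = x"
proof (induction n arbitrary: x)
  case 0
  then show ?case using F_closed(4) by (intro bexI[of _ 0]) (simp_all add: F_0)
next
  case (Suc n)
  \<comment> \<open>The value 1 is the vector with both entries 1; it serves only as a nonzero
    element of V.\<close>
  obtain y where y: "y \<in> F (Suc (Suc n))" "quot (Suc n) y = 1" by (rule quot_surj)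
  then have y': "y \<notin> F (Suc n)" using quot_eq_0_iff[of y "Suc n"] by simp
  have Zy: "Z y \<in> F (Suc n)" "Z y \<notin> F n"
  proof -
    show "Z y \<in> F (Suc n)" using y(1) by (rule Z_F)
    show "Z y \<notin> F n"
    proof
      assume "Z y \<in> F n"
      then obtain u where u: "u \<in> F (Suc n)" "Z u = Z y" using Suc.IH by blast
      then have "y - u \<in> F (Suc 0)" by (simp only: Z_eq_0_iff[symmetric] Z_diff diff_self)
      then have "y - u \<in> F (Suc n)" using F_mono[of 1 "Suc n"] by simp
      then have "y - u + u \<in> F (Suc n)" using u(1) by (rule F_closed)
      then show False using y' by simp
    qed
  qed
  \<comment> \<open>The image of \<open>Z\<close> in the quotient V is an invariant subspace,
    nonzero because of \<open>y\<close>, hence all of V. The remaining error in \<open>F n\<close>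
    is handled by induction.\<close>
  have "quot n x \<in> {quot n (Z z) | z. z \<in> F (Suc (Suc n))}" (is "_ \<in> ?X")
  proof (rule std_irreducible)
    show "quot n (Z y) \<in> ?X" using y by blast
    show "quot n (Z y) \<noteq> 0" using quot_eq_0_iff Zy by blast
    show "v + w \<in> ?X" if v: "v \<in> ?X" and w: "w \<in> ?X" for v w
    proof -
      obtain a where a: "v = quot n (Z a)" "a \<in> F (Suc (Suc n))" using v by blast
      obtain b where b: "w = quot n (Z b)" "b \<in> F (Suc (Suc n))" using w by blast
      from a b have "v + w = quot n (Z (a + b))" by (simp add: quot_simps Z_F)
      then show ?thesis using a b F_closed(1) by blast
    qed
    show "c *s v \<in> ?X" if v: "v \<in> ?X" for c v
    proof -
      obtain a where a: "v = quot n (Z a)" "a \<in> F (Suc (Suc n))" using v by blast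
      then have "c *s v = quot n (Z (smul c a))" by (simp add: quot_simps Z_F)
      then show ?thesis using a F_closed(3) by blast
    qed
    show "std_action Smat v \<in> ?X" if v: "v \<in> ?X" for v
    proof -
      obtain a where a: "v = quot n (Z a)" "a \<in> F (Suc (Suc n))" using v by blast
      then have "std_action Smat v = quot n (Z (S a))" by (simp add: quot_simps Z_F Z_S)
      then show ?thesis using a F_rho SL2Z_gens by blast
    qed
    show "std_action Rmat v \<in> ?X" if v: "v \<in> ?X" for v
    proof -
      obtain a where a: "v = quot n (Z a)" "a \<in> F (Suc (Suc n))" using v by blast
      then have "std_action Rmat v = quot n (Z (R a))" by (simp add: quot_simps Z_F Z_R)
      then show ?thesis using a F_rho SL2Z_gens by blast
    qed
  qed
  then obtain z where z: "z \<in> F (Suc (Suc n))" "quot n x = quot n (Z z)" by blast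
  then have "quot n (x - Z z) = 0" using quot_simps Suc.prems Z_F by simp
  then have "x - Z z \<in> F n" using quot_eq_0_iff Suc.prems Z_F z(1) F_closed(2) by blast
  then obtain z' where z': "z' \<in> F (Suc n)" "Z z' = x - Z z" using Suc.IH by blast
  then have "Z (z + z') = x" "z + z' \<in> F (Suc (Suc n))"
    using z(1) F_Suc by (simp_all add: F_closed)
  then show ?case by blast
qed

lemma Z_surj: "\<exists>y. Z y = x"
  using F_Un Z_surj_F by blast

text \<open>\<open>R - (1 - omega)\<close> maps into the \<open>omega\<close>-eigenspace, multiplies
  its elements by \<open>2 * omega - 1\<close> and commutes with \<open>Z\<close>; so any preimage
  can be projected.\<close>

lemma Z_surj_eigenspace:
  assumes "R w = smul omega w"
  shows "\<exists>u. R u = smul omega u \<and> Z u = w"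
proof -
  obtain x where x: "Z x = w" using Z_surj by blast
  define u where "u = smul (inverse (2 * omega - 1)) (R x - smul (1 - omega) x)"
  have nz: "2 * omega - 1 \<noteq> 0" using two_omega_neq_1 by simp
  have "R (R x - smul (1 - omega) x) = smul omega (R x - smul (1 - omega) x)"
    by (simp add: R_R algebra_simps omega_omega)
  then have "R u = smul omega u"
    by (simp add: u_def)
  moreover have "Z u = w"
  proof -
    have "Z (R x - smul (1 - omega) x) = smul (2 * omega - 1) w"
      by (simp add: Z_R x assms flip: scale_left_diff_distrib)
    then show ?thesis using nz by (simp add: u_def)
  qed
  ultimately show ?thesis by blast
qed

text \<open>The first filtration step is a copy of V; \<open>w\<close> is the preimage of the
  \<open>omega\<close>-eigenvector \<open>(1, -omega)\<close>, as in the model.\<close>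

lemma base_vector:
  obtains w where "R w = smul omega w" "w \<in> F (Suc 0)"
    "\<And>a b. smul a w + smul b (S w) = 0 \<Longrightarrow> a = 0 \<and> b = 0"
    "\<And>x. x \<in> F (Suc 0) \<Longrightarrow> \<exists>a b. x = smul a w + smul b (S w)"
proof -
  obtain w where w: "w \<in> F (Suc 0)" "quot 0 w = vector [1, - omega]" by (rule quot_surj)
  have Rw: "R w = smul omega w"
    by (rule quot_0_inj) (simp_all add: w quot_simps F_closed std_action_gens vec_eq_iff forall_2 omega_omega)
  have qab: "quot 0 (smul a w + smul b (S w)) = vector [a - omega * b, - omega * a - b]" for a b
    using w by (simp add: quot_simps F_closed std_action_gens vec_eq_iff forall_2)
  show thesis
  proof (rule that[OF Rw w(1)])
    fix a b assume "smul a w + smul b (S w) = 0"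
    moreover have "quot 0 0 = 0" using quot_scale[of 0 0 0] F_closed(4) by simp
    ultimately have "vector [a - omega * b, - omega * a - b] = (0 :: complex ^ 2)"
      using qab[of a b] by simp
    from arg_cong[OF this, of "\<lambda>v. v $ 1"] arg_cong[OF this, of "\<lambda>v. v $ 2"]
    have 1: "a = omega * b" and 2: "- omega * a = b" by simp_all
    from 2 have "omega * b = 0" unfolding 1 by (simp add: omega_omega_mult)
    then show "a = 0 \<and> b = 0" using 1 omega_nonzero by simp
  next
    fix x assume x: "x \<in> F (Suc 0)"
    define a where "a = (quot 0 x $ 1 - omega * quot 0 x $ 2) / omega"
    define b where "b = - quot 0 x $ 2 - omega * a"
    have "a - omega * b = quot 0 x $ 1" "- omega * a - b = quot 0 x $ 2"
      using omega_nonzero omega_omega by (simp_all add: b_def a_def field_simps omega_omega_mult)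
    then have "x = smul a w + smul b (S w)"
      by (intro quot_0_inj) (simp_all add: qab x w F_closed vec_eq_iff forall_2)
    then show "\<exists>a b. x = smul a w + smul b (S w)" by blast
  qed
qed

section \<open>The isomorphism from the model\<close>

definition lincomb :: "(nat \<Rightarrow> 'v) \<Rightarrow> complex poly \<Rightarrow> 'v" where
  "lincomb w a = (\<Sum>k\<le>degree a. smul (coeff a k) (w k))"

lemma lincomb_eq:
  assumes "degree a \<le> n"
  shows "lincomb w a = (\<Sum>k\<le>n. smul (coeff a k) (w k))"
  unfolding lincomb_def
  by (rule sum.mono_neutral_left) (use assms in \<open>auto simp: coeff_eq_0\<close>)

lemma lincomb_0 [simp]: "lincomb w 0 = 0"
  by (simp add: lincomb_def)

lemma lincomb_add [simp]: "lincomb w (a + b) = lincomb w a + lincomb w b"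
  using degree_add_le_max[of a b]
  by (simp add: lincomb_eq[of _ "max (degree a) (degree b)"] scale_left_distrib sum.distrib)

lemma lincomb_smult [simp]: "lincomb w (smult c a) = smul c (lincomb w a)"
  using degree_smult_le[of c a]
  by (simp add: lincomb_eq[of _ "degree a"] scale_sum_right)

lemma lincomb_minus [simp]: "lincomb w (- a) = - lincomb w a"
  using lincomb_smult[of w "- 1" a] by simp

lemma lincomb_pCons [simp]: "lincomb w (pCons c a) = smul c (w 0) + lincomb (\<lambda>k. w (Suc k)) a"
  unfolding lincomb_eq[OF degree_pCons_le] sum.atMost_Suc_shift by (simp add: lincomb_def)

lemma lincomb_map:
  assumes "\<And>x y. h (x + y) = h x + h y" "\<And>c x. h (smul c x) = smul c (h x)"
  shows "h (lincomb w a) = lincomb (\<lambda>k. h (w k)) a"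
proof (induction a arbitrary: w rule: pCons_induct)
  case 0
  show ?case using assms(2)[of 0 0] by simp
qed (simp add: assms)

lemma isomorphic_model: "CG_isomorphic smult model_rep smul rho"
proof -
  obtain w0 where w0: "R w0 = smul omega w0" "w0 \<in> F (Suc 0)"
    "\<And>a b. smul a w0 + smul b (S w0) = 0 \<Longrightarrow> a = 0 \<and> b = 0"
    "\<And>x. x \<in> F (Suc 0) \<Longrightarrow> \<exists>a b. x = smul a w0 + smul b (S w0)"
    using base_vector by metis
  \<comment> \<open>The chain stays in the \<open>omega\<close>-eigenspace, so that every next
    choice exists; the clause for \<open>n = 0\<close> pins its start at \<open>w0\<close>.\<close>
  have "\<exists>w. \<forall>n. (R (w n) = smul omega (w n) \<and> (n = 0 \<longrightarrow> w n = w0)) \<and> Z (w (Suc n)) = w n"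
    by (rule dependent_nat_choice) (use w0(1) Z_surj_eigenspace in auto)
  then obtain w where Rw: "\<And>n. R (w n) = smul omega (w n)" and w_0: "w 0 = w0"
    and Zw: "\<And>n. Z (w (Suc n)) = w n" by blast
  let ?L = "lincomb w"
  have RL: "R (?L a) = smul omega (?L a)" for a
    using lincomb_map[of R w a] lincomb_map[of "smul omega" w a]
    by (simp add: Rw scale_right_distrib mult.commute)
  have ZL: "Z (?L a) = ?L (poly_shift 1 a)" for a
  proof (cases a)
    case (pCons c a')
    have "poly_shift 1 (pCons c a') = a'"
      by (simp add: poly_eq_iff coeff_poly_shift)
    moreover have "Z w0 = 0" using w0(2) Z_eq_0_iff by simp
    ultimately show ?thesis
      using lincomb_map[of Z "\<lambda>k. w (Suc k)" a'] by (simp add: pCons w_0 Zw)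
  qed
  define f where "f p = ?L (ev p) + S (?L (od p))" for p
  have f_add: "f (p + q) = f p + f q" and f_scale: "f (smult c p) = smul c (f p)" for p q c
    by (simp_all add: f_def scale_right_distrib)
  have f_S: "f (model_S p) = S (f p)" for p
    by (simp add: f_def S_S)
  have f_R: "f (model_R p) = R (f p)" for p
  proof -
    \<comment> \<open>Solving the definition of \<open>Z\<close> for \<open>R S\<close> yields the
      second row and column of the formula for \<open>model_R\<close>.\<close>
    have "R (S x) = Z x - S (R x) + S x + smul 2 x" for x
      by (simp add: Z_def)
    then have "R (S (?L a)) = ?L (poly_shift 1 a) - smul omega (S (?L a)) + S (?L a) + smul 2 (?L a)" for a
      by (simp add: RL ZL)
    then show ?thesis
      by (simp add: f_def RL algebra_simps)
  qed
  have f_shift: "f (model_shift p) = Z (f p)" for p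
    by (simp add: f_def ZL Z_S)
  have f_const: "f (weave [:a:] [:b:]) = smul a w0 + smul b (S w0)" for a b
    by (simp add: f_def w_0)
  have f_rho: "f (model_rep g p) = rho g (f p)" if "g \<in> SL2Z" for g p
    using that
    by (induction rule: SL2Z_induct)
      (simp_all add: model.rep_one model.rep_mult model.rep_S model.rep_R rho_one rho_mult f_S f_R)
  \<comment> \<open>Since \<open>f\<close> turns the shift into \<open>Z\<close>, the shift of a
    kernel element is again in the kernel and vanishes by induction. What remains are constants,
    where \<open>w0\<close> and \<open>S w0\<close> are independent.\<close>
  have "p = 0" if "p \<in> model_F n" "f p = 0" for p n
    using that
  proof (induction n arbitrary: p)
    case 0
    then show ?case by (simp add: model_F_0)
  next
    case (Suc n)
    have "model_shift p = 0"
      using Suc by (intro Suc.IH) (simp_all add: model_F_shift f_shift)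
    then have "poly_shift 1 (ev p) = 0" "poly_shift 1 (od p) = 0"
      by (metis ev_od_model_shift ev_od_simps(1,2))+
    moreover have const: "a = [:coeff a 0:]" if "poly_shift 1 a = 0" for a :: "complex poly"
    proof -
      have "coeff a (Suc k) = 0" for k
        using arg_cong[OF that, of "\<lambda>q. coeff q k"] by (simp add: coeff_poly_shift)
      then show ?thesis by (simp add: poly_eq_iff coeff_pCons split: nat.split)
    qed
    ultimately obtain a b where ab: "ev p = [:a:]" "od p = [:b:]" by metis
    then have p: "p = weave [:a:] [:b:]" using weave_ev_od[of p] by simp
    with Suc.prems(2) have "a = 0 \<and> b = 0" by (intro w0(3)) (simp add: f_const)
    then show ?case using p by (simp add: poly_eq_iff coeff_weave)
  qed
  then have ker: "p = 0" if "f p = 0" for p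
    using that model_F_Un by blast
  have inj: "inj f"
  proof (rule injI)
    fix p q assume "f p = f q"
    then have "f (p + smult (- 1) q) = 0" by (simp only: f_add f_scale) simp
    from ker[OF this] show "p = q" by simp
  qed
  have "\<exists>p. f p = x" if "x \<in> F n" for x n
    using that
  proof (induction n arbitrary: x)
    case 0
    then show ?case using f_scale[of 0 0] by (auto simp: F_0)
  next
    case (Suc n)
    then obtain q where q: "f q = Z x" using Z_F by blast
    \<comment> \<open>A preimage of \<open>q\<close> under the shift; then \<open>x - f p\<close>
      lies in the kernel of \<open>Z\<close>, that is in \<open>F (Suc 0)\<close>, which the
      constants cover.\<close>
    define p where "p = weave (pCons 0 (ev q)) (pCons 0 (od q))"
    have "model_shift p = q"
      by (rule ev_od_eqI) (simp_all add: p_def poly_eq_iff coeff_poly_shift del: coeff_ev coeff_od)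
    then have "Z (x - f p) = 0" using f_shift[of p] q by simp
    then obtain a b where "x - f p = smul a w0 + smul b (S w0)"
      using w0(4) Z_eq_0_iff by blast
    then have "f (p + weave [:a:] [:b:]) = x" by (simp add: f_add f_const algebra_simps)
    then show ?case by blast
  qed
  then have "\<exists>p. x = f p" for x using F_Un[of x] by metis
  then have "bij f" using inj by (simp add: bij_def surj_def)
  moreover have "Vector_Spaces.linear smult smul f"
    using vector_space_axioms by (simp add: Vector_Spaces.linear_iff vector_space_smult f_add f_scale)
  ultimately show ?thesis
    unfolding CG_isomorphic_def using f_rho by (intro exI[of _ f]) auto
qed

end

section \<open>Symmetry and transitivity of isomorphism, and the conclusion through the
  model\<close>

lemma CG_isomorphic_sym:
  assumes "CG_isomorphic sa ra sb rb"
  shows "CG_isomorphic sb rb sa ra"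
proof -
  obtain f where f: "bij f" "Vector_Spaces.linear sa sb f" "\<And>g. g \<in> SL2Z \<Longrightarrow> f \<circ> ra g = rb g \<circ> f"
    using assms unfolding CG_isomorphic_def by blast
  have inv: "f (inv f x) = x" "inv f (f y) = y" for x y
    using f(1) by (simp_all add: bij_def surj_f_inv_f)
  have lin: "f (x + y) = f x + f y" "f (sa c x) = sb c (f x)" for x y c
    using f(2) by (simp_all add: Vector_Spaces.linear_iff)
  have "inv f (x + y) = inv f x + inv f y" for x y
    using inv(2)[of "inv f x + inv f y"] by (simp add: lin inv(1))
  moreover have "inv f (sb c x) = sa c (inv f x)" for x c
    using inv(2)[of "sa c (inv f x)"] by (simp add: lin inv(1))
  ultimately have "Vector_Spaces.linear sb sa (inv f)"
    using f(2) by (simp add: Vector_Spaces.linear_iff)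
  moreover have "inv f \<circ> rb g = ra g \<circ> inv f" if "g \<in> SL2Z" for g
  proof
    fix x
    have "f (ra g (inv f x)) = rb g x"
      using fun_cong[OF f(3)[OF that], of "inv f x"] by (simp add: inv(1))
    then show "(inv f \<circ> rb g) x = (ra g \<circ> inv f) x"
      using inv(2)[of "ra g (inv f x)"] by simp
  qed
  ultimately show ?thesis
    unfolding CG_isomorphic_def using bij_imp_bij_inv[OF f(1)] by blast
qed

lemma CG_isomorphic_trans:
  assumes "CG_isomorphic sa ra sb rb" "CG_isomorphic sb rb sc rc"
  shows "CG_isomorphic sa ra sc rc"
proof -
  obtain f where f: "bij f" "Vector_Spaces.linear sa sb f" "\<And>g. g \<in> SL2Z \<Longrightarrow> f \<circ> ra g = rb g \<circ> f"
    using assms(1) unfolding CG_isomorphic_def by blast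
  obtain h where h: "bij h" "Vector_Spaces.linear sb sc h" "\<And>g. g \<in> SL2Z \<Longrightarrow> h \<circ> rb g = rc g \<circ> h"
    using assms(2) unfolding CG_isomorphic_def by blast
  have "h \<circ> f \<circ> ra g = rc g \<circ> (h \<circ> f)" if "g \<in> SL2Z" for g
    using f(3)[OF that] h(3)[OF that] by (metis comp_assoc)
  moreover have "Vector_Spaces.linear sa sc (h \<circ> f)"
    using f(2) h(2) by (simp add: Vector_Spaces.linear_iff)
  ultimately show ?thesis
    unfolding CG_isomorphic_def using bij_comp[OF f(1) h(1)] by blast
qed

theorem theorem8p1:
  shows "(\<exists>(rho :: int ^ 2 ^ 2 \<Rightarrow> complex poly \<Rightarrow> complex poly) F.
            CG_module smult rho \<and> T_indecomposable smult rho \<and> good_filtration smult rho F)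
       \<and> (\<forall>(sa :: complex \<Rightarrow> 'a::ab_group_add \<Rightarrow> 'a) ra Fa (sb :: complex \<Rightarrow> 'b::ab_group_add \<Rightarrow> 'b) rb Fb.
            CG_module sa ra \<and> T_indecomposable sa ra \<and> good_filtration sa ra Fa \<and>
            CG_module sb rb \<and> T_indecomposable sb rb \<and> good_filtration sb rb Fb
            \<longrightarrow> CG_isomorphic sa ra sb rb)"
proof (intro conjI allI impI)
  show "\<exists>(rho :: int ^ 2 ^ 2 \<Rightarrow> complex poly \<Rightarrow> complex poly) F.
      CG_module smult rho \<and> T_indecomposable smult rho \<and> good_filtration smult rho F"
    using CG_module_model T_indecomposable_model good_filtration_model by blast
next
  fix sa :: "complex \<Rightarrow> 'a \<Rightarrow> 'a" and ra Fa and sb :: "complex \<Rightarrow> 'b \<Rightarrow> 'b" and rb Fb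
  assume *: "CG_module sa ra \<and> T_indecomposable sa ra \<and> good_filtration sa ra Fa \<and>
    CG_module sb rb \<and> T_indecomposable sb rb \<and> good_filtration sb rb Fb"
  then interpret a: std_filtered_module sa ra Fa
    by (simp add: std_filtered_module_def std_filtered_module_axioms_def CG_module_def)
  from * interpret b: std_filtered_module sb rb Fb
    by (simp add: std_filtered_module_def std_filtered_module_axioms_def CG_module_def)
  show "CG_isomorphic sa ra sb rb"
    using a.isomorphic_model b.isomorphic_model CG_isomorphic_sym CG_isomorphic_trans by blast
qed

end
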